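(* Let $X$ be an open well-filtered ($T_0$) space. Then the upper space $\mathcal{D}(X)$ (the set of all nonempty compact saturated subsets of $X$ equipped with the upper Vietoris topology) is open well-filtered.
   Context: For a topological space $X$, $\mathcal{O}(X)$ denotes the collection of open sets of $X$, ordered by inclusion. For $U,V\in\mathcal{O}(X)$, $U\ll V$ means that $U$ is way-below $V$ in the poset $(\mathcal{O}(X),\subseteq)$: for every directed family $\mathcal{W}\subseteq\mathcal{O}(X)$ with $V\subseteq\bigcup\mathcal{W}$ there is $W\in\mathcal{W}$ with $U\subseteq W$ (directed families are nonempty). A nonempty family $\mathcal{F}\subseteq\mathcal{O}(X)$ is $\ll$-filtered if for any $U_1,U_2\in\mathcal{F}$ there exists $U_3\in\mathcal{F}$ such that $U_3\ll U_1$ and $U_3\ll U_2$. A $T_0$ space $X$ is open well-filtered if for every $\ll$-filtered family $\mathcal{F}\subseteq\mathcal{O}(X)$ and every $U\in\mathcal{O}(X)$, $\bigcap\mathcal{F}\subseteq U$ implies $V\subseteq U$ for some $V\in\mathcal{F}$. A subset $A$ of $X$ is saturated if it equals the intersection of all open sets containing it. $\mathcal{D}(X)$ is the set of all nonempty compact saturated subsets of $X$. The upper Vietoris topology on $\mathcal{D}(X)$ is the topology having $\{\Box U: U\in\mathcal{O}(X)\}$ as a base, where $\Box U=\{K\in\mathcal{D}(X): K\subseteq U\}$. Compactness means every open cover has a finite subcover (no separation assumed). *)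

theory Defs
  imports "HOL-Analysis.Analysis"
begin

definition directed_family :: "'a set set \<Rightarrow> bool" where
  "directed_family \<W> \<longleftrightarrow>
     \<W> \<noteq> {} \<and> (\<forall>A\<in>\<W>. \<forall>B\<in>\<W>. \<exists>C\<in>\<W>. A \<subseteq> C \<and> B \<subseteq> C)"

text \<open>The supremum of a family in the poset of open sets is its union.\<close>

definition way_below_in :: "'a topology \<Rightarrow> 'a set \<Rightarrow> 'a set \<Rightarrow> bool" where
  "way_below_in X U V \<longleftrightarrow>
     openin X U \<and> openin X V \<and>
     (\<forall>\<W>. (\<forall>W\<in>\<W>. openin X W) \<and> directed_family \<W> \<and> V \<subseteq> \<Union>\<W> \<longrightarrow> (\<exists>W\<in>\<W>. U \<subseteq> W))"

definition way_below_filtered :: "'a topology \<Rightarrow> 'a set set \<Rightarrow> bool" where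
  "way_below_filtered X \<F> \<longleftrightarrow>
     \<F> \<noteq> {} \<and> (\<forall>U\<in>\<F>. openin X U) \<and>
     (\<forall>U1\<in>\<F>. \<forall>U2\<in>\<F>. \<exists>U3\<in>\<F>. way_below_in X U3 U1 \<and> way_below_in X U3 U2)"

definition open_well_filtered :: "'a topology \<Rightarrow> bool" where
  "open_well_filtered X \<longleftrightarrow>
     t0_space X \<and>
     (\<forall>\<F> U. way_below_filtered X \<F> \<and> openin X U \<and> \<Inter>\<F> \<subseteq> U \<longrightarrow> (\<exists>V\<in>\<F>. V \<subseteq> U))"

text \<open>The explicit carrier condition is needed: \<open>\<Inter>{}\<close> is the whole type, so \<open>UNIV\<close> would
  satisfy the equation even when the carrier is smaller.\<close>

definition saturated_in :: "'a topology \<Rightarrow> 'a set \<Rightarrow> bool" where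
  "saturated_in X A \<longleftrightarrow> A \<subseteq> topspace X \<and> A = \<Inter>{U. openin X U \<and> A \<subseteq> U}"

definition compact_saturated_sets :: "'a topology \<Rightarrow> 'a set set" where
  "compact_saturated_sets X = {K. K \<noteq> {} \<and> compactin X K \<and> saturated_in X K}"

definition upper_box :: "'a topology \<Rightarrow> 'a set \<Rightarrow> 'a set set" where
  "upper_box X U = {K \<in> compact_saturated_sets X. K \<subseteq> U}"

definition upper_space :: "'a topology \<Rightarrow> 'a set topology" where
  "upper_space X = topology (arbitrary union_of (\<lambda>B. \<exists>U. openin X U \<and> B = upper_box X U))"

text \<open>The boxes are closed under binary intersection, so \<open>topology\<close> is applied to an actual
  topology, and the carrier of the upper space is the set of all nonempty compact saturated sets.\<close>

lemma openin_upper_space: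
  "openin (upper_space X) = arbitrary union_of (\<lambda>B. \<exists>U. openin X U \<and> B = upper_box X U)"
proof -
  have "upper_box X U \<inter> upper_box X V = upper_box X (U \<inter> V)" for U V
    by (auto simp: upper_box_def)
  then have "istopology (arbitrary union_of (\<lambda>B. \<exists>U. openin X U \<and> B = upper_box X U))"
    by (intro istopology_base) (metis openin_Int)
  then show ?thesis
    unfolding upper_space_def by (rule topology_inverse')
qed

lemma openin_upper_box: "openin X U \<Longrightarrow> openin (upper_space X) (upper_box X U)"
  unfolding openin_upper_space by (intro arbitrary_union_of_inc) blast

lemma topspace_upper_space: "topspace (upper_space X) = compact_saturated_sets X"
proof
  show "topspace (upper_space X) \<subseteq> compact_saturated_sets X"
    unfolding topspace_def openin_upper_space
    by (auto simp: union_of_def upper_box_def subset_iff)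
  have "upper_box X (topspace X) = compact_saturated_sets X"
    by (auto simp: upper_box_def compact_saturated_sets_def dest: compactin_subset_topspace)
  then show "compact_saturated_sets X \<subseteq> topspace (upper_space X)"
    by (metis openin_topspace openin_subset openin_upper_box)
qed

end

theory Submission
  imports Defs
begin

text \<open>Let \<open>\<F>\<close> be a \<open>\<lless>\<close>-filtered family of open sets of the upper space, none of whose
  members lies in the open set \<open>\<U>\<close>. By Zorn there is a maximal open \<open>\<C> \<supseteq> \<U>\<close> that contains
  no member of \<open>\<F>\<close>. Since the complement of \<open>\<C>\<close> is closed under enlarging compact saturated
  sets, each \<open>\<Union>(\<V> - \<C>)\<close> is open in \<open>X\<close>, and these sets form a \<open>\<lless>\<close>-filtered family
  as \<open>\<V>\<close> runs through \<open>\<F>\<close>. Open well-filteredness of \<open>X\<close> makes its intersection \<open>K\<close>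
  compact and saturated with \<open>K \<notin> \<C>\<close>, and maximality of \<open>\<C>\<close> puts \<open>K\<close> inside every compact
  saturated set outside \<open>\<C>\<close>. Hence \<open>K\<close> belongs to \<open>\<Inter>\<F>\<close> but not to \<open>\<U>\<close>.\<close>

section \<open>Directed families of sets and compactness\<close>

lemma directed_family_chain:
  assumes "\<W> \<noteq> {}" "\<And>A B. A \<in> \<W> \<Longrightarrow> B \<in> \<W> \<Longrightarrow> A \<subseteq> B \<or> B \<subseteq> A"
  shows "directed_family \<W>"
  unfolding directed_family_def using assms by (metis subset_refl)

lemma directed_family_finite_Unions: "directed_family {\<Union>\<G> |\<G>. finite \<G> \<and> \<G> \<subseteq> \<U>}"
  unfolding directed_family_def
proof (intro conjI ballI)
  show "{\<Union>\<G> |\<G>. finite \<G> \<and> \<G> \<subseteq> \<U>} \<noteq> {}"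
    by blast
next
  fix A B assume "A \<in> {\<Union>\<G> |\<G>. finite \<G> \<and> \<G> \<subseteq> \<U>}" "B \<in> {\<Union>\<G> |\<G>. finite \<G> \<and> \<G> \<subseteq> \<U>}"
  then obtain \<G> \<H> where "finite \<G>" "\<G> \<subseteq> \<U>" "A = \<Union>\<G>" "finite \<H>" "\<H> \<subseteq> \<U>" "B = \<Union>\<H>"
    by blast
  then have "\<Union>(\<G> \<union> \<H>) \<in> {\<Union>\<G> |\<G>. finite \<G> \<and> \<G> \<subseteq> \<U>}"
    by (intro CollectI exI[of _ "\<G> \<union> \<H>"]) simp
  moreover have "A \<subseteq> \<Union>(\<G> \<union> \<H>)" "B \<subseteq> \<Union>(\<G> \<union> \<H>)"
    using \<open>A = \<Union>\<G>\<close> \<open>B = \<Union>\<H>\<close> by auto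
  ultimately show "\<exists>C\<in>{\<Union>\<G> |\<G>. finite \<G> \<and> \<G> \<subseteq> \<U>}. A \<subseteq> C \<and> B \<subseteq> C"
    by (intro bexI conjI)
qed

text \<open>A finite subcover has an upper bound in a directed family, by induction on its size;
  nonemptiness of \<open>\<W>\<close> settles the empty subcover.\<close>

lemma directed_family_compactin_subset:
  assumes "directed_family \<W>" "\<And>W. W \<in> \<W> \<Longrightarrow> openin X W" "compactin X K" "K \<subseteq> \<Union>\<W>"
  obtains W where "W \<in> \<W>" "K \<subseteq> W"
proof -
  obtain \<G> where "finite \<G>" "\<G> \<subseteq> \<W>" "K \<subseteq> \<Union>\<G>"
    using assms(2-4) unfolding compactin_def by meson
  moreover have "\<exists>W\<in>\<W>. \<Union>\<G> \<subseteq> W"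
    using \<open>finite \<G>\<close> \<open>\<G> \<subseteq> \<W>\<close>
  proof (induction \<G>)
    case empty
    then show ?case
      using assms(1) by (auto simp: directed_family_def)
  next
    case (insert G \<G>)
    then obtain W where "W \<in> \<W>" "\<Union>\<G> \<subseteq> W"
      by auto
    moreover obtain W' where "W' \<in> \<W>" "G \<subseteq> W'" "W \<subseteq> W'"
      using assms(1) insert.prems \<open>W \<in> \<W>\<close> unfolding directed_family_def by blast
    ultimately show ?case
      by auto
  qed
  ultimately show thesis
    using that by (meson order_trans)
qed

lemma way_below_inD:
  assumes "way_below_in X U V" "\<And>W. W \<in> \<W> \<Longrightarrow> openin X W" "directed_family \<W>" "V \<subseteq> \<Union>\<W>"
  obtains W where "W \<in> \<W>" "U \<subseteq> W"
  using assms unfolding way_below_in_def by metis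

section \<open>Filtered families for the way-below relation\<close>

lemma way_below_filtered_nonempty: "way_below_filtered X \<F> \<Longrightarrow> \<F> \<noteq> {}"
  by (simp add: way_below_filtered_def)

lemma way_below_filtered_openin: "way_below_filtered X \<F> \<Longrightarrow> V \<in> \<F> \<Longrightarrow> openin X V"
  by (simp add: way_below_filtered_def)

lemma way_below_filtered_refine:
  assumes "way_below_filtered X \<F>" "V \<in> \<F>"
  obtains V' where "V' \<in> \<F>" "way_below_in X V' V"
  using assms unfolding way_below_filtered_def by blast

text \<open>Zorn applies because avoiding \<open>\<F>\<close> survives unions of chains: if such a
  union covered \<open>V\<close>, then a member \<open>V'\<close> of \<open>\<F>\<close> way below
  \<open>V\<close> would already lie in one element of the chain.\<close>

lemma way_below_filtered_maximal_open:
  assumes \<F>: "way_below_filtered X \<F>" and U: "openin X U" "\<And>V. V \<in> \<F> \<Longrightarrow> \<not> V \<subseteq> U"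
  obtains C where "openin X C" "U \<subseteq> C" "\<And>V. V \<in> \<F> \<Longrightarrow> \<not> V \<subseteq> C"
    "\<And>D. openin X D \<Longrightarrow> C \<subset> D \<Longrightarrow> \<exists>V\<in>\<F>. V \<subseteq> D"
proof -
  let ?\<A> = "{C. openin X C \<and> U \<subseteq> C \<and> (\<forall>V\<in>\<F>. \<not> V \<subseteq> C)}"
  have "\<exists>M\<in>?\<A>. \<forall>D\<in>?\<A>. M \<subseteq> D \<longrightarrow> D = M"
  \<comment> \<open>This form of Zorn asks only for nonempty chains, which are exactly those that
    count as directed families.\<close>
  proof (rule subset_Zorn_nonempty)
    show "?\<A> \<noteq> {}"
      using U by blast
  next
    fix \<C> assume ne: "\<C> \<noteq> {}" and chain: "subset.chain ?\<A> \<C>"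
    then have sub: "\<C> \<subseteq> ?\<A>"
      by (simp add: subset_chain_def)
    have dir: "directed_family \<C>"
      using ne chain by (intro directed_family_chain) (simp_all add: subset_chain_def)
    have "\<not> V \<subseteq> \<Union>\<C>" if V: "V \<in> \<F>" for V
    proof
      assume "V \<subseteq> \<Union>\<C>"
      obtain V' where "V' \<in> \<F>" "way_below_in X V' V"
        using way_below_filtered_refine[OF \<F> V] .
      then obtain C where "C \<in> \<C>" "V' \<subseteq> C"
        using way_below_inD[of X V' V \<C>] sub dir \<open>V \<subseteq> \<Union>\<C>\<close> by blast
      then show False
        using sub \<open>V' \<in> \<F>\<close> by blast
    qed
    moreover have "openin X (\<Union>\<C>)"
      using sub by blast
    moreover have "U \<subseteq> \<Union>\<C>"
      using sub ne by blast
    ultimately show "\<Union>\<C> \<in> ?\<A>"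
      by blast
  qed
  then obtain M where M: "M \<in> ?\<A>" and max: "\<forall>D\<in>?\<A>. M \<subseteq> D \<longrightarrow> D = M"
    by (rule bexE)
  show thesis
  proof (rule that)
    fix D assume "openin X D" "M \<subset> D"
    moreover have "D \<notin> ?\<A>"
      using bspec[OF max, of D] \<open>M \<subset> D\<close> by (simp only: psubset_eq) (rule notI, simp)
    ultimately show "\<exists>V\<in>\<F>. V \<subseteq> D"
      using M by auto
  qed (use M in auto)
qed

section \<open>Saturated and compact saturated sets\<close>

lemma saturated_inI:
  assumes "A \<subseteq> topspace X"
    "\<And>y. y \<in> topspace X \<Longrightarrow> y \<notin> A \<Longrightarrow> \<exists>U. openin X U \<and> A \<subseteq> U \<and> y \<notin> U"
  shows "saturated_in X A"
proof -
  have "\<Inter>{U. openin X U \<and> A \<subseteq> U} \<subseteq> A"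
  proof
    fix y assume y: "y \<in> \<Inter>{U. openin X U \<and> A \<subseteq> U}"
    \<comment> \<open>The carrier is itself one of the open supersets of \<open>A\<close>.\<close>
    then have "y \<in> topspace X"
      using assms(1) by simp
    moreover have "y \<in> U" if "openin X U" "A \<subseteq> U" for U
      using y that by simp
    ultimately show "y \<in> A"
      using assms(2)[of y] by metis
  qed
  then have "A = \<Inter>{U. openin X U \<and> A \<subseteq> U}"
    by (intro subset_antisym) auto
  with assms(1) show ?thesis
    unfolding saturated_in_def by (rule conjI)
qed

lemma saturated_in_separate:
  assumes "saturated_in X A" "y \<notin> A"
  obtains U where "openin X U" "A \<subseteq> U" "y \<notin> U"
proof -
  have "y \<notin> \<Inter>{U. openin X U \<and> A \<subseteq> U}"
    using assms by (simp add: saturated_in_def)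
  then show thesis
    using that by auto
qed

lemma saturated_in_Un:
  assumes "saturated_in X A" "saturated_in X B"
  shows "saturated_in X (A \<union> B)"
proof (rule saturated_inI)
  show "A \<union> B \<subseteq> topspace X"
    using assms by (auto simp: saturated_in_def)
next
  fix y assume "y \<notin> A \<union> B"
  then obtain U V where "openin X U" "A \<subseteq> U" "y \<notin> U" "openin X V" "B \<subseteq> V" "y \<notin> V"
    using saturated_in_separate assms by (metis UnCI)
  then show "\<exists>W. openin X W \<and> A \<union> B \<subseteq> W \<and> y \<notin> W"
    by (intro exI[of _ "U \<union> V"]) auto
qed

lemma compact_saturated_sets_Un:
  "A \<in> compact_saturated_sets X \<Longrightarrow> B \<in> compact_saturated_sets X
    \<Longrightarrow> A \<union> B \<in> compact_saturated_sets X"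
  by (simp add: compact_saturated_sets_def saturated_in_Un compactin_Un)

text \<open>Any open set around \<open>x\<close> contains all of \<open>?S\<close>, so a single
  member of a cover suffices. Taking the union with \<open>?S\<close> adjoins a point to a compact
  saturated set without leaving that class.\<close>

lemma compact_saturated_saturation_point:
  assumes x: "x \<in> topspace X"
  shows "\<Inter>{U. openin X U \<and> x \<in> U} \<in> compact_saturated_sets X" (is "?S \<in> _")
proof -
  have sub: "?S \<subseteq> topspace X"
    using x by (intro Inter_lower) simp
  have "saturated_in X ?S"
    by (rule saturated_inI[OF sub]) blast
  moreover have "compactin X ?S"
    unfolding compactin_def
  proof (intro conjI allI impI sub)
    fix \<U> assume \<U>: "Ball \<U> (openin X) \<and> ?S \<subseteq> \<Union>\<U>"
    moreover have "x \<in> ?S"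
      by blast
    ultimately obtain U where "U \<in> \<U>" "x \<in> U"
      by blast
    with \<U> show "\<exists>\<G>. finite \<G> \<and> \<G> \<subseteq> \<U> \<and> ?S \<subseteq> \<Union>\<G>"
      by (intro exI[of _ "{U}"]) auto
  qed
  ultimately show ?thesis
    by (auto simp: compact_saturated_sets_def)
qed

section \<open>Intersections of filtered families in an open well-filtered space\<close>

lemma open_well_filteredD:
  "open_well_filtered X \<Longrightarrow> way_below_filtered X \<F> \<Longrightarrow> openin X U \<Longrightarrow> \<Inter>\<F> \<subseteq> U
    \<Longrightarrow> \<exists>V\<in>\<F>. V \<subseteq> U"
  by (simp add: open_well_filtered_def)

text \<open>An open cover of the intersection already covers some \<open>V\<close> in
  \<open>\<F>\<close>, and a member way below \<open>V\<close> is then covered by finitely many of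
  its sets.\<close>

lemma open_well_filtered_Inter:
  assumes X: "open_well_filtered X" and \<F>: "way_below_filtered X \<F>" and ne: "{} \<notin> \<F>"
  shows "\<Inter>\<F> \<in> compact_saturated_sets X"
proof -
  have wf: "\<exists>V\<in>\<F>. V \<subseteq> U" if "openin X U" "\<Inter>\<F> \<subseteq> U" for U
    using open_well_filteredD[OF X \<F> that] .
  have sub: "\<Inter>\<F> \<subseteq> topspace X"
    using way_below_filtered_nonempty[OF \<F>] way_below_filtered_openin[OF \<F>]
    by (meson Inter_lower ex_in_conv openin_subset order_trans)
  \<comment> \<open>If the intersection were empty, well-filteredness with the open set
    \<open>{}\<close> would force \<open>{}\<close> into \<open>\<F>\<close>.\<close>
  have "\<Inter>\<F> \<noteq> {}"
    using wf[of "{}"] ne by auto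
  moreover have "saturated_in X (\<Inter>\<F>)"
    using way_below_filtered_openin[OF \<F>] by (intro saturated_inI sub) blast
  moreover have "compactin X (\<Inter>\<F>)"
    unfolding compactin_def
  proof (intro conjI allI impI sub)
    fix \<U> assume \<U>: "Ball \<U> (openin X) \<and> \<Inter>\<F> \<subseteq> \<Union>\<U>"
    then have "openin X (\<Union>\<U>)"
      by blast
    then obtain V where V: "V \<in> \<F>" "V \<subseteq> \<Union>\<U>"
      using wf \<U> by blast
    obtain V' where V': "V' \<in> \<F>" "way_below_in X V' V"
      using way_below_filtered_refine[OF \<F> V(1)] .
    \<comment> \<open>Finite unions turn an arbitrary cover into a directed one, to which the
      way-below relation applies.\<close>
    define \<W> where "\<W> = {\<Union>\<G> |\<G>. finite \<G> \<and> \<G> \<subseteq> \<U>}"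
    have "\<U> \<subseteq> \<W>"
      unfolding \<W>_def by (force intro: exI[of _ "{_}"])
    then have "V \<subseteq> \<Union>\<W>"
      using V(2) by (meson Union_mono order_trans)
    moreover have "openin X W" if "W \<in> \<W>" for W
      using that \<U> unfolding \<W>_def by blast
    moreover have "directed_family \<W>"
      unfolding \<W>_def by (rule directed_family_finite_Unions)
    ultimately obtain W where "W \<in> \<W>" "V' \<subseteq> W"
      using way_below_inD[OF V'(2)] by metis
    then obtain \<G> where "finite \<G>" "\<G> \<subseteq> \<U>" "V' \<subseteq> \<Union>\<G>"
      unfolding \<W>_def by blast
    with V'(1) show "\<exists>\<G>. finite \<G> \<and> \<G> \<subseteq> \<U> \<and> \<Inter>\<F> \<subseteq> \<Union>\<G>"
      by (meson Inter_lower order_trans)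
  qed
  ultimately show ?thesis
    by (simp add: compact_saturated_sets_def)
qed

section \<open>Open sets and separation in the upper space\<close>

lemma openin_upper_space_subset:
  "openin (upper_space X) \<V> \<Longrightarrow> K \<in> \<V> \<Longrightarrow> K \<in> compact_saturated_sets X"
  using openin_subset[of "upper_space X"] by (auto simp: topspace_upper_space)

lemma openin_upper_space_box:
  assumes "openin (upper_space X) \<V>" "K \<in> \<V>"
  obtains U where "openin X U" "K \<subseteq> U" "upper_box X U \<subseteq> \<V>"
proof -
  obtain \<B> where \<B>: "\<And>B. B \<in> \<B> \<Longrightarrow> \<exists>U. openin X U \<and> B = upper_box X U" "\<V> = \<Union>\<B>"
    using assms(1) by (auto simp: openin_upper_space union_of_def)
  then obtain U where "openin X U" "upper_box X U \<in> \<B>" "K \<in> upper_box X U"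
    using assms(2) by (metis UnionE)
  then show thesis
    using that[of U] \<B>(2) by (auto simp: upper_box_def)
qed

text \<open>Boxes pass to smaller compact saturated sets, hence so do their unions. Dually,
  enlarging a set outside an open \<open>\<V>\<close> keeps it outside.\<close>

lemma openin_upper_space_mono:
  assumes "openin (upper_space X) \<V>" "L \<in> \<V>" "K \<in> compact_saturated_sets X" "K \<subseteq> L"
  shows "K \<in> \<V>"
proof -
  obtain U where "openin X U" "L \<subseteq> U" "upper_box X U \<subseteq> \<V>"
    using openin_upper_space_box[OF assms(1,2)] .
  then show ?thesis
    using assms(3,4) by (auto simp: upper_box_def)
qed

lemma t0_space_upper_space: "t0_space (upper_space X)"
proof -
  have sep: "\<exists>\<V>. openin (upper_space X) \<V> \<and> (K \<notin> \<V>) = (L \<in> \<V>)"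
    if "K \<in> compact_saturated_sets X" "L \<in> compact_saturated_sets X" "x \<in> K" "x \<notin> L" for K L x
  proof -
    have "saturated_in X L"
      using that by (simp add: compact_saturated_sets_def)
    then obtain U where "openin X U" "L \<subseteq> U" "x \<notin> U"
      using saturated_in_separate \<open>x \<notin> L\<close> by metis
    \<comment> \<open>The box of \<open>U\<close> contains \<open>L\<close> but not
      \<open>K\<close>, since \<open>x\<close> lies in \<open>K\<close> and not in
      \<open>U\<close>.\<close>
    then show ?thesis
      using that openin_upper_box[of X U]
      by (intro exI[of _ "upper_box X U"]) (auto simp: upper_box_def)
  qed
  show ?thesis
    unfolding t0_space_def topspace_upper_space
  proof (intro ballI impI)
    fix K L assume *: "K \<in> compact_saturated_sets X" "L \<in> compact_saturated_sets X" "K \<noteq> L"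
    then consider x where "x \<in> K" "x \<notin> L" | x where "x \<in> L" "x \<notin> K"
      by blast
    then show "\<exists>\<V>. openin (upper_space X) \<V> \<and> (K \<notin> \<V>) = (L \<in> \<V>)"
      using * sep[of K L] sep[of L K] by cases blast+
  qed
qed

section \<open>Passing from the upper space down to the base space\<close>

text \<open>Around \<open>K\<close> in \<open>\<V> - \<C>\<close> take an open \<open>W\<close>
  whose box lies in \<open>\<V>\<close>. For \<open>y\<close> in \<open>W\<close>, enlarging
  \<open>K\<close> by the saturation of \<open>y\<close> stays within that box, and it stays outside
  \<open>\<C>\<close> because \<open>K\<close> is outside.\<close>

lemma openin_Union_diff:
  assumes \<V>: "openin (upper_space X) \<V>" and \<C>: "openin (upper_space X) \<C>"
  shows "openin X (\<Union>(\<V> - \<C>))"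
proof (subst openin_subopen, intro ballI)
  fix x assume "x \<in> \<Union>(\<V> - \<C>)"
  then obtain K where K: "K \<in> \<V>" "K \<notin> \<C>" "x \<in> K"
    by blast
  then obtain W where W: "openin X W" "K \<subseteq> W" "upper_box X W \<subseteq> \<V>"
    using openin_upper_space_box[OF \<V>] by blast
  have Kc: "K \<in> compact_saturated_sets X"
    using openin_upper_space_subset[OF \<V> K(1)] .
  have "y \<in> \<Union>(\<V> - \<C>)" if y: "y \<in> W" for y
  proof -
    let ?S = "\<Inter>{U. openin X U \<and> y \<in> U}"
    have "?S \<in> compact_saturated_sets X"
      using openin_subset[OF W(1)] y by (intro compact_saturated_saturation_point) blast
    then have "K \<union> ?S \<in> compact_saturated_sets X"
      by (rule compact_saturated_sets_Un[OF Kc])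
    moreover have "K \<union> ?S \<subseteq> W"
      using W y by blast
    ultimately have "K \<union> ?S \<in> \<V>"
      using W(3) by (auto simp: upper_box_def)
    moreover have "K \<union> ?S \<notin> \<C>"
      using openin_upper_space_mono[OF \<C> _ Kc] K(2) by blast
    ultimately show ?thesis
      by blast
  qed
  with W K(3) show "\<exists>T. openin X T \<and> x \<in> T \<and> T \<subseteq> \<Union>(\<V> - \<C>)"
    by blast
qed

text \<open>A directed cover of \<open>\<Union>(\<V>' - \<C>)\<close> lifts to a directed cover of
  \<open>\<V>'\<close>: replace each \<open>W\<close> by its box together with \<open>\<C>\<close>.
  If one such set contains \<open>\<V>\<close>, then every element of \<open>\<V> - \<C>\<close>
  lies in the box of \<open>W\<close>, so their union lies in \<open>W\<close>.\<close>

lemma way_below_in_Union_diff: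
  assumes wb: "way_below_in (upper_space X) \<V> \<V>'" and \<C>: "openin (upper_space X) \<C>"
  shows "way_below_in X (\<Union>(\<V> - \<C>)) (\<Union>(\<V>' - \<C>))"
proof -
  have op: "openin (upper_space X) \<V>" "openin (upper_space X) \<V>'"
    using wb by (auto simp: way_below_in_def)
  have "\<exists>W\<in>\<W>. \<Union>(\<V> - \<C>) \<subseteq> W"
    if \<W>: "\<And>W. W \<in> \<W> \<Longrightarrow> openin X W" "directed_family \<W>" "\<Union>(\<V>' - \<C>) \<subseteq> \<Union>\<W>" for \<W>
  proof -
    let ?f = "\<lambda>W. upper_box X W \<union> \<C>"
    have mono: "?f V \<subseteq> ?f W" if "V \<subseteq> W" for V W
      using that by (auto simp: upper_box_def)
    have "directed_family (?f ` \<W>)"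
      using \<W>(2) mono unfolding directed_family_def by (simp, meson)
    moreover have "openin (upper_space X) B" if "B \<in> ?f ` \<W>" for B
      using that \<W>(1) \<C> by (auto intro: openin_upper_box)
    moreover have "\<V>' \<subseteq> \<Union>(?f ` \<W>)"
    proof
      fix K assume K: "K \<in> \<V>'"
      show "K \<in> \<Union>(?f ` \<W>)"
      proof (cases "K \<in> \<C>")
        case True
        \<comment> \<open>Every lifted set contains \<open>\<C>\<close>, so any member of the
          nonempty \<open>\<W>\<close> will do.\<close>
        then show ?thesis
          using \<W>(2) by (auto simp: directed_family_def)
      next
        case False
        have Kc: "K \<in> compact_saturated_sets X"
          using openin_upper_space_subset[OF op(2) K] .
        then have "compactin X K"
          by (simp add: compact_saturated_sets_def)
        moreover have "K \<subseteq> \<Union>\<W>"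
          using \<W>(3) K False by blast
        ultimately obtain W where "W \<in> \<W>" "K \<subseteq> W"
          using directed_family_compactin_subset[OF \<W>(2,1)] by metis
        with Kc show ?thesis
          by (auto simp: upper_box_def)
      qed
    qed
    ultimately obtain B where "B \<in> ?f ` \<W>" "\<V> \<subseteq> B"
      using way_below_inD[OF wb] by metis
    then show ?thesis
      by (auto simp: upper_box_def)
  qed
  then show ?thesis
    unfolding way_below_in_def using op[THEN openin_Union_diff, OF \<C>] by simp
qed

lemma way_below_filtered_Union_diff:
  assumes \<F>: "way_below_filtered (upper_space X) \<F>" and \<C>: "openin (upper_space X) \<C>"
  shows "way_below_filtered X ((\<lambda>\<V>. \<Union>(\<V> - \<C>)) ` \<F>)"
  unfolding way_below_filtered_def
proof (intro conjI ballI)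
  show "(\<lambda>\<V>. \<Union>(\<V> - \<C>)) ` \<F> \<noteq> {}"
    using way_below_filtered_nonempty[OF \<F>] by simp
next
  fix U assume "U \<in> (\<lambda>\<V>. \<Union>(\<V> - \<C>)) ` \<F>"
  then show "openin X U"
    using openin_Union_diff[OF way_below_filtered_openin[OF \<F>] \<C>] by blast
next
  fix U1 U2 assume "U1 \<in> (\<lambda>\<V>. \<Union>(\<V> - \<C>)) ` \<F>" "U2 \<in> (\<lambda>\<V>. \<Union>(\<V> - \<C>)) ` \<F>"
  then obtain \<V>1 \<V>2 where "\<V>1 \<in> \<F>" "\<V>2 \<in> \<F>" "U1 = \<Union>(\<V>1 - \<C>)" "U2 = \<Union>(\<V>2 - \<C>)"
    by blast
  moreover obtain \<V>3 where "\<V>3 \<in> \<F>"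
    "way_below_in (upper_space X) \<V>3 \<V>1" "way_below_in (upper_space X) \<V>3 \<V>2"
    using \<F> \<open>\<V>1 \<in> \<F>\<close> \<open>\<V>2 \<in> \<F>\<close> unfolding way_below_filtered_def by blast
  ultimately show "\<exists>U3\<in>(\<lambda>\<V>. \<Union>(\<V> - \<C>)) ` \<F>. way_below_in X U3 U1 \<and> way_below_in X U3 U2"
    using way_below_in_Union_diff[OF _ \<C>] by blast
qed

section \<open>The maximal avoiding open set and the resulting common element\<close>

theorem theorem4p2:
  fixes X :: "'a topology"
  assumes "open_well_filtered X"
  shows "open_well_filtered (upper_space X)"
  unfolding open_well_filtered_def
proof (intro conjI allI impI t0_space_upper_space)
  fix \<F> \<U>
  assume *: "way_below_filtered (upper_space X) \<F> \<and> openin (upper_space X) \<U> \<and> \<Inter>\<F> \<subseteq> \<U>"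
  then have \<F>: "way_below_filtered (upper_space X) \<F>"
    by blast
  show "\<exists>\<V>\<in>\<F>. \<V> \<subseteq> \<U>"
  proof (rule ccontr)
    assume "\<not> (\<exists>\<V>\<in>\<F>. \<V> \<subseteq> \<U>)"
    then obtain \<C> where \<C>: "openin (upper_space X) \<C>" "\<U> \<subseteq> \<C>"
      and avoid: "\<And>\<V>. \<V> \<in> \<F> \<Longrightarrow> \<not> \<V> \<subseteq> \<C>"
      and max: "\<And>\<D>. openin (upper_space X) \<D> \<Longrightarrow> \<C> \<subset> \<D> \<Longrightarrow> \<exists>\<V>\<in>\<F>. \<V> \<subseteq> \<D>"
      using * way_below_filtered_maximal_open[OF \<F>] by metis
    let ?G = "(\<lambda>\<V>. \<Union>(\<V> - \<C>)) ` \<F>"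
    define K where "K = \<Inter>?G"
    have G: "way_below_filtered X ?G"
      by (rule way_below_filtered_Union_diff[OF \<F> \<C>(1)])
    have "\<Union>(\<V> - \<C>) \<noteq> {}" if \<V>: "\<V> \<in> \<F>" for \<V>
    proof -
      obtain L where "L \<in> \<V>" "L \<notin> \<C>"
        using avoid[OF \<V>] by blast
      moreover have "L \<noteq> {}"
        using openin_upper_space_subset[OF way_below_filtered_openin[OF \<F> \<V>] \<open>L \<in> \<V>\<close>]
        by (simp add: compact_saturated_sets_def)
      ultimately show ?thesis
        by blast
    qed
    then have "{} \<notin> ?G"
      by (metis (no_types, lifting) imageE)
    then have Kc: "K \<in> compact_saturated_sets X"
      unfolding K_def by (rule open_well_filtered_Inter[OF assms G])
    \<comment> \<open>Otherwise a box of some \<open>U\<close> with \<open>K \<subseteq> U\<close>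
      lies in \<open>\<C>\<close>, and well-filteredness of \<open>X\<close> puts some
      \<open>\<Union>(\<V> - \<C>)\<close> inside \<open>U\<close>. The elements of
      \<open>\<V> - \<C>\<close> then lie in that box, so
      \<open>\<V> \<subseteq> \<C>\<close>.\<close>
    have "K \<notin> \<C>"
    proof
      assume "K \<in> \<C>"
      then obtain U where U: "openin X U" "K \<subseteq> U" "upper_box X U \<subseteq> \<C>"
        using openin_upper_space_box[OF \<C>(1)] by blast
      then have "\<exists>V\<in>?G. V \<subseteq> U"
        using open_well_filteredD[OF assms G] unfolding K_def by metis
      then obtain \<V> where \<V>: "\<V> \<in> \<F>" "\<Union>(\<V> - \<C>) \<subseteq> U"
        by (metis (no_types, lifting) imageE)
      have "L \<in> \<C>" if "L \<in> \<V>" for L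
      proof (rule ccontr)
        assume "L \<notin> \<C>"
        with \<V>(2) that have "L \<subseteq> U"
          by blast
        moreover have "L \<in> compact_saturated_sets X"
          using openin_upper_space_subset[OF way_below_filtered_openin[OF \<F> \<V>(1)] that] .
        ultimately show False
          using U(3) \<open>L \<notin> \<C>\<close> by (auto simp: upper_box_def)
      qed
      then have "\<V> \<subseteq> \<C>"
        by (rule subsetI)
      with avoid \<V>(1) show False
        by blast
    qed
    have K_sub: "K \<subseteq> L" if L: "L \<in> compact_saturated_sets X" "L \<notin> \<C>" for L
    proof
      fix x assume x: "x \<in> K"
      show "x \<in> L"
      proof (rule ccontr)
        assume "x \<notin> L"
        moreover have "saturated_in X L"
          using L(1) by (simp add: compact_saturated_sets_def)
        ultimately obtain O' where O': "openin X O'" "L \<subseteq> O'" "x \<notin> O'"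
          using saturated_in_separate by metis
        \<comment> \<open>Adding the box of \<open>O'\<close> enlarges \<open>\<C>\<close> properly,
          as \<open>L\<close> is new. By maximality some \<open>\<V>\<close> in \<open>\<F>\<close>
          fits inside, so \<open>K \<subseteq> \<Union>(\<V> - \<C>) \<subseteq> O'\<close>,
          contrary to the choice of \<open>O'\<close>.\<close>
        have "openin (upper_space X) (\<C> \<union> upper_box X O')"
          using \<C>(1) O'(1) by (intro openin_Un openin_upper_box)
        moreover have "\<C> \<subset> \<C> \<union> upper_box X O'"
          using L O'(2) by (auto simp: upper_box_def)
        ultimately obtain \<V> where "\<V> \<in> \<F>" "\<V> \<subseteq> \<C> \<union> upper_box X O'"
          using max by blast
        with x O'(3) show False
          by (auto simp: K_def upper_box_def)
      qed
    qed
    \<comment> \<open>Each \<open>\<V>\<close> has an element \<open>L\<close> outside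
      \<open>\<C>\<close>; as \<open>K \<subseteq> L\<close>, downward closure of
      \<open>\<V>\<close> gives the claim.\<close>
    have "K \<in> \<V>" if \<V>: "\<V> \<in> \<F>" for \<V>
    proof -
      obtain L where L: "L \<in> \<V>" "L \<notin> \<C>"
        using avoid[OF \<V>] by blast
      have "openin (upper_space X) \<V>"
        by (rule way_below_filtered_openin[OF \<F> \<V>])
      then show ?thesis
        using openin_upper_space_mono L Kc K_sub openin_upper_space_subset by metis
    qed
    with * \<C>(2) \<open>K \<notin> \<C>\<close> show False
      by blast
  qed
qed

end
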